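(* There is an absolute constant $C_0<6.7129$ such that for every $n\ge1$ and every family $\eta_1,\dots,\eta_n$ of admissible measures on $\mathbb R$, \[ T\Big(\Big(\tfrac1n\sum_{i=1}^n\eta_i\Big)^{*n}\Big)\le C_0\,T(\eta_1*\cdots*\eta_n). \]
   Context: A finitely supported positive measure $\eta$ on $\mathbb R$ is called admissible if $\int_{\mathbb R}e^x\,\eta(dx)=1$ and $\int_{\mathbb R}e^{-x}\,\eta(dx)=1$. For such $\eta$, $T(\eta):=\frac12\int_{\mathbb R}|e^x-e^{-x}|\,\eta(dx)$. $*$ denotes convolution of measures and $\eta^{*n}$ the $n$-fold convolution of $\eta$ with itself. *)

theory Defs
  imports Complex_Main
begin

text \<open>A finitely supported positive measure on the reals is represented by its
weight function: eta x is the mass of the atom at x.\<close>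

definition supp_fm :: "(real \<Rightarrow> real) \<Rightarrow> real set" where
  "supp_fm \<eta> = {x. \<eta> x \<noteq> 0}"

definition fin_pos_measure :: "(real \<Rightarrow> real) \<Rightarrow> bool" where
  "fin_pos_measure \<eta> \<longleftrightarrow> finite (supp_fm \<eta>) \<and> (\<forall>x. 0 \<le> \<eta> x)"

definition fm_integral :: "(real \<Rightarrow> real) \<Rightarrow> (real \<Rightarrow> real) \<Rightarrow> real" where
  "fm_integral \<eta> f = (\<Sum>x\<in>supp_fm \<eta>. \<eta> x * f x)"

definition admissible :: "(real \<Rightarrow> real) \<Rightarrow> bool" where
  "admissible \<eta> \<longleftrightarrow> fin_pos_measure \<eta> \<and>
     fm_integral \<eta> exp = 1 \<and> fm_integral \<eta> (\<lambda>x. exp (- x)) = 1"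

definition T :: "(real \<Rightarrow> real) \<Rightarrow> real" where
  "T \<eta> = (1/2) * fm_integral \<eta> (\<lambda>x. \<bar>exp x - exp (- x)\<bar>)"

definition fm_conv :: "(real \<Rightarrow> real) \<Rightarrow> (real \<Rightarrow> real) \<Rightarrow> (real \<Rightarrow> real)" where
  "fm_conv \<mu> \<nu> = (\<lambda>z. \<Sum>x\<in>supp_fm \<mu>. \<mu> x * \<nu> (z - x))"

definition dirac0 :: "real \<Rightarrow> real" where
  "dirac0 = (\<lambda>x. if x = 0 then 1 else 0)"

fun fm_conv_pow :: "(real \<Rightarrow> real) \<Rightarrow> nat \<Rightarrow> (real \<Rightarrow> real)" where
  "fm_conv_pow \<eta> 0 = dirac0"
| "fm_conv_pow \<eta> (Suc n) = fm_conv (fm_conv_pow \<eta> n) \<eta>"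

fun fm_conv_prod :: "(nat \<Rightarrow> real \<Rightarrow> real) \<Rightarrow> nat \<Rightarrow> (real \<Rightarrow> real)" where
  "fm_conv_prod \<eta> 0 = dirac0"
| "fm_conv_prod \<eta> (Suc n) = fm_conv (fm_conv_prod \<eta> n) (\<eta> n)"

end

theory Submission
  imports Defs "HOL-Combinatorics.Permutations" "HOL-Analysis.Convex"
begin

text \<open>Write \<open>\<tau>(A)\<close> for \<open>T\<close> of the convolution of the \<open>\<eta>\<^sub>i\<close>, \<open>i \<in> A\<close>, so that
  \<open>\<delta> = \<tau>({..<n})\<close> is the right hand side. Since \<open>T \<le> 1\<close>, only \<open>\<delta> \<le> 1/6\<close> matters for the constant \<open>6\<close>.

  The convolution power of the average is the mean, over all words \<open>i\<^sub>1 \<dots> i\<^sub>n\<close>, of the convolutions of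
  the \<open>\<eta>\<close> along the word. A word splits into layers \<open>A\<^sub>k\<close>, the set of letters occurring at least \<open>k\<close>
  times, and \<open>\<tau>\<close> is subadditive and monotone; so the first two layers cost at most \<open>2 \<delta>\<close>.

  The layers with \<open>k \<ge> 3\<close> are small: \<open>A\<^sub>k\<close> has mean size at most \<open>n / k!\<close>, and the mean of \<open>\<tau>\<close> over
  sets of size \<open>a\<close> is at most of order \<open>sqrt (a / n) \<delta>\<close>. To see this, split \<open>{..<n}\<close> into \<open>m\<close> blocks \<open>B\<^sub>j\<close>.
  Since \<open>T\<close> is the integral of \<open>\<bar>sinh\<bar>\<close> and does not change when a measure is reflected, attaching random
  signs to the blocks at most doubles \<open>\<delta>\<close>. The mean of \<open>\<bar>sinh (\<Sum> \<epsilon>\<^sub>j x\<^sub>j)\<bar>\<close> over the signs dominates that of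
  \<open>\<bar>\<Sum> \<epsilon>\<^sub>j sinh x\<^sub>j\<bar>\<close>, and Jensen's and Khintchine's inequalities give \<open>\<Sum> \<tau>(B\<^sub>j) = O(sqrt m \<delta>)\<close>.\<close>

section \<open>Finitely supported measures\<close>

lemma fm_integral_superset:
  assumes "finite S" "supp_fm \<mu> \<subseteq> S"
  shows "fm_integral \<mu> f = (\<Sum>x\<in>S. \<mu> x * f x)"
  unfolding fm_integral_def
  by (rule sum.mono_neutral_left) (use assms in \<open>auto simp: supp_fm_def\<close>)

lemma supp_fm_conv_subset:
  "supp_fm (fm_conv \<mu> \<nu>) \<subseteq> (\<lambda>(x, y). x + y) ` (supp_fm \<mu> \<times> supp_fm \<nu>)"
proof
  fix z assume "z \<in> supp_fm (fm_conv \<mu> \<nu>)"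
  then have "(\<Sum>x\<in>supp_fm \<mu>. \<mu> x * \<nu> (z - x)) \<noteq> 0"
    by (simp add: supp_fm_def fm_conv_def)
  then obtain x where x: "x \<in> supp_fm \<mu>" "\<mu> x * \<nu> (z - x) \<noteq> 0"
    by (meson sum.neutral)
  then have "(x, z - x) \<in> supp_fm \<mu> \<times> supp_fm \<nu>"
    by (auto simp: supp_fm_def)
  then show "z \<in> (\<lambda>(x, y). x + y) ` (supp_fm \<mu> \<times> supp_fm \<nu>)"
    by (force intro: image_eqI[where x = "(x, z - x)"])
qed

lemma finite_supp_fm_conv:
  assumes "finite (supp_fm \<mu>)" "finite (supp_fm \<nu>)"
  shows "finite (supp_fm (fm_conv \<mu> \<nu>))"
  using finite_subset[OF supp_fm_conv_subset] assms by blast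

lemma fm_integral_conv:
  assumes fin: "finite (supp_fm \<mu>)" "finite (supp_fm \<nu>)"
  shows "fm_integral (fm_conv \<mu> \<nu>) f = fm_integral \<mu> (\<lambda>x. fm_integral \<nu> (\<lambda>y. f (x + y)))"
proof -
  define Z where "Z = (\<lambda>(x, y). x + y) ` (supp_fm \<mu> \<times> supp_fm \<nu>)"
  have Z: "finite Z" "supp_fm (fm_conv \<mu> \<nu>) \<subseteq> Z"
    using fin supp_fm_conv_subset by (auto simp: Z_def)
  have inner: "(\<Sum>z\<in>Z. \<nu> (z - x) * f z) = fm_integral \<nu> (\<lambda>y. f (x + y))"
    if x: "x \<in> supp_fm \<mu>" for x
  proof -
    have "(\<Sum>z\<in>Z. \<nu> (z - x) * f z) = (\<Sum>z\<in>(+) x ` supp_fm \<nu>. \<nu> (z - x) * f z)"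
    proof (rule sum.mono_neutral_right)
      show "(+) x ` supp_fm \<nu> \<subseteq> Z"
        using x by (force simp: Z_def)
      show "\<forall>z\<in>Z - (+) x ` supp_fm \<nu>. \<nu> (z - x) * f z = 0"
      proof
        fix z assume z: "z \<in> Z - (+) x ` supp_fm \<nu>"
        have "\<nu> (z - x) = 0"
        proof (rule ccontr)
          assume "\<nu> (z - x) \<noteq> 0"
          then have "x + (z - x) \<in> (+) x ` supp_fm \<nu>"
            by (intro imageI) (simp add: supp_fm_def)
          with z show False by simp
        qed
        then show "\<nu> (z - x) * f z = 0" by simp
      qed
    qed (use Z in auto)
    also have "\<dots> = fm_integral \<nu> (\<lambda>y. f (x + y))"
      by (simp add: sum.reindex fm_integral_def)
    finally show ?thesis .
  qed
  have "fm_integral (fm_conv \<mu> \<nu>) f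
      = (\<Sum>z\<in>Z. \<Sum>x\<in>supp_fm \<mu>. \<mu> x * (\<nu> (z - x) * f z))"
    by (subst fm_integral_superset[OF Z])
       (simp add: fm_conv_def sum_distrib_right mult.assoc)
  also have "\<dots> = (\<Sum>x\<in>supp_fm \<mu>. \<mu> x * (\<Sum>z\<in>Z. \<nu> (z - x) * f z))"
    by (subst sum.swap) (simp add: sum_distrib_left)
  also have "\<dots> = fm_integral \<mu> (\<lambda>x. fm_integral \<nu> (\<lambda>y. f (x + y)))"
    using inner by (simp add: fm_integral_def)
  finally show ?thesis .
qed

lemma supp_fm_dirac0: "supp_fm dirac0 = {0}"
  by (auto simp: supp_fm_def dirac0_def)

lemma fm_integral_dirac0: "fm_integral dirac0 f = f 0"
  by (simp add: fm_integral_def supp_fm_dirac0) (simp add: dirac0_def)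

lemma admissible_dirac0: "admissible dirac0"
  by (simp add: admissible_def fin_pos_measure_def fm_integral_dirac0 supp_fm_dirac0)
     (simp add: dirac0_def)

lemma finite_supp_fm_conv_pow:
  "finite (supp_fm \<mu>) \<Longrightarrow> finite (supp_fm (fm_conv_pow \<mu> n))"
  by (induction n) (auto simp: supp_fm_dirac0 finite_supp_fm_conv)

lemma finite_supp_fm_conv_prod:
  "(\<And>i. i < n \<Longrightarrow> finite (supp_fm (\<eta> i))) \<Longrightarrow> finite (supp_fm (fm_conv_prod \<eta> n))"
  by (induction n) (auto simp: supp_fm_dirac0 finite_supp_fm_conv)

lemma fm_integral_add: "fm_integral \<mu> (\<lambda>x. f x + g x) = fm_integral \<mu> f + fm_integral \<mu> g"
  by (simp add: fm_integral_def algebra_simps sum.distrib)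

lemma fm_integral_cmult: "fm_integral \<mu> (\<lambda>x. c * f x) = c * fm_integral \<mu> f"
  by (simp add: fm_integral_def algebra_simps sum_distrib_left)

lemma fm_integral_mono:
  assumes "fin_pos_measure \<mu>" "\<And>x. f x \<le> g x"
  shows "fm_integral \<mu> f \<le> fm_integral \<mu> g"
  unfolding fm_integral_def
  by (rule sum_mono) (use assms in \<open>auto simp: fin_pos_measure_def intro: mult_left_mono\<close>)

lemma T_eq: "T \<mu> = fm_integral \<mu> (\<lambda>x. \<bar>sinh x\<bar>)"
proof -
  have "\<bar>sinh x\<bar> = 1 / 2 * \<bar>exp x - exp (- x)\<bar>" for x :: real
    by (simp add: sinh_def abs_mult)
  then show ?thesis by (simp only: T_def fm_integral_cmult)
qed

text \<open>Half the sum and half the difference of the two admissibility conditions. In this form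
  the addition formulas carry them through convolutions.\<close>

lemma admissible_cosh: "admissible \<mu> \<Longrightarrow> fm_integral \<mu> cosh = 1"
  and admissible_sinh: "admissible \<mu> \<Longrightarrow> fm_integral \<mu> sinh = 0"
proof -
  assume adm: "admissible \<mu>"
  have c: "cosh = (\<lambda>x::real. 1/2 * exp x + 1/2 * exp (- x))"
    by (auto simp: cosh_def scaleR_conv_of_real algebra_simps)
  have s: "sinh = (\<lambda>x::real. 1/2 * exp x + (- 1/2) * exp (- x))"
    by (auto simp: sinh_def scaleR_conv_of_real algebra_simps)
  show "fm_integral \<mu> cosh = 1" "fm_integral \<mu> sinh = 0"
    unfolding c s fm_integral_add fm_integral_cmult using adm by (simp_all add: admissible_def)
qed

section \<open>Even convex functions and the Khintchine inequality\<close>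

text \<open>Convexity in the form of supporting lines, which is what Jensen's inequality uses.\<close>

definition even_convex :: "(real \<Rightarrow> real) \<Rightarrow> bool" where
  "even_convex \<phi> \<longleftrightarrow> (\<forall>z. \<phi> (- z) = \<phi> z) \<and> (\<forall>z. \<exists>c. \<forall>s. \<phi> z + c * (s - z) \<le> \<phi> s)"

lemma even_convexE:
  assumes "even_convex \<phi>"
  obtains c where "\<And>s. \<phi> z + c * (s - z) \<le> \<phi> s"
  using assms unfolding even_convex_def by blast

text \<open>Since \<open>a\<close> lies between \<open>b\<close> and \<open>- b\<close>, the
  supporting line at \<open>a\<close> does not descend towards at least one of these points, and
  \<open>\<phi>\<close> has the same value at both.\<close>

lemma even_convex_mono:
  assumes "even_convex \<phi>" "\<bar>a\<bar> \<le> \<bar>b\<bar>"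
  shows "\<phi> a \<le> \<phi> b"
proof -
  obtain c where c: "\<And>s. \<phi> a + c * (s - a) \<le> \<phi> s"
    using even_convexE[OF assms(1)] by blast
  have ev: "\<phi> (- b) = \<phi> b" using assms by (simp add: even_convex_def)
  have "0 \<le> c * (b - a) \<or> 0 \<le> c * (- b - a)"
    using assms(2) by (auto simp: zero_le_mult_iff)
  then show ?thesis using c[of b] c[of "- b"] ev by auto
qed

lemma even_convex_abs: "even_convex abs"
proof -
  have "\<bar>z\<bar> + sgn z * (s - z) \<le> \<bar>s\<bar>" for s z :: real
    by (auto simp: sgn_real_def)
  then show ?thesis by (auto simp: even_convex_def)
qed

lemma even_convex_avg:
  assumes "even_convex \<phi>"
  shows "even_convex (\<lambda>z. (\<phi> (z + t) + \<phi> (z - t)) / 2)"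
  unfolding even_convex_def
proof (intro conjI allI)
  have ev: "\<phi> (- z) = \<phi> z" for z using assms by (simp add: even_convex_def)
  fix z
  show "(\<phi> (- z + t) + \<phi> (- z - t)) / 2 = (\<phi> (z + t) + \<phi> (z - t)) / 2"
    using ev[of "z + t"] ev[of "z - t"] by (simp add: algebra_simps minus_diff_commute)
  obtain c where c: "\<And>s. \<phi> (z + t) + c * (s - (z + t)) \<le> \<phi> s"
    using even_convexE[OF assms] by blast
  obtain d where d: "\<And>s. \<phi> (z - t) + d * (s - (z - t)) \<le> \<phi> s"
    using even_convexE[OF assms] by blast
  have "(\<phi> (z + t) + \<phi> (z - t)) / 2 + (c + d) / 2 * (s - z) \<le> (\<phi> (s + t) + \<phi> (s - t)) / 2" for s
    using c[of "s + t"] d[of "s - t"] by (simp add: field_simps)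
  then show "\<exists>c. \<forall>s. (\<phi> (z + t) + \<phi> (z - t)) / 2 + c * (s - z)
      \<le> (\<phi> (s + t) + \<phi> (s - t)) / 2" by blast
qed

lemma even_convex_avg_swap:
  assumes "even_convex \<phi>"
  shows "(\<phi> (z + t) + \<phi> (z - t)) / 2 = (\<phi> (t + z) + \<phi> (t - z)) / 2"
proof -
  have "\<phi> (- (z - t)) = \<phi> (z - t)" using assms unfolding even_convex_def by blast
  then show ?thesis by (simp add: add.commute)
qed

text \<open>One argument at a time: the average is even and convex in \<open>a\<close> for fixed
  \<open>b\<close>, and symmetric in the two arguments.\<close>

lemma even_convex_avg_mono:
  assumes "even_convex \<phi>" "\<bar>a\<bar> \<le> \<bar>a'\<bar>" "\<bar>b\<bar> \<le> \<bar>b'\<bar>"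
  shows "(\<phi> (a + b) + \<phi> (a - b)) / 2 \<le> (\<phi> (a' + b') + \<phi> (a' - b')) / 2"
proof -
  have "(\<phi> (a + b) + \<phi> (a - b)) / 2 \<le> (\<phi> (a' + b) + \<phi> (a' - b)) / 2"
    using even_convex_mono[OF even_convex_avg[OF assms(1)] assms(2)] .
  also have "\<dots> \<le> (\<phi> (a' + b') + \<phi> (a' - b')) / 2"
    using even_convex_mono[OF even_convex_avg[OF assms(1)] assms(3), of a']
    by (simp only: even_convex_avg_swap[OF assms(1)])
  finally show ?thesis .
qed

lemma even_convex_support_nonneg:
  assumes "even_convex \<phi>" "0 \<le> t"
  shows "\<exists>c\<ge>0. \<forall>s. \<phi> t + c * (s - t) \<le> \<phi> s"
proof (cases "t = 0")
  case True
  then show ?thesis using even_convex_mono[OF assms(1), of 0] by auto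
next
  case False
  obtain c where c: "\<And>s. \<phi> t + c * (s - t) \<le> \<phi> s"
    using even_convexE[OF assms(1)] by blast
  have "\<phi> (- t) = \<phi> t" using assms by (simp add: even_convex_def)
  with c[of "- t"] have "0 \<le> c * t" by (simp add: algebra_simps)
  with False assms(2) have "0 \<le> c" by (simp add: zero_le_mult_iff)
  with c show ?thesis by blast
qed

section \<open>Rademacher averages\<close>

text \<open>The mean of \<open>\<bar>u + \<Sum>\<^sub>j \<epsilon>\<^sub>j t\<^sub>j\<bar>\<close>
  over independent fair signs; the shift \<open>u\<close> is carried along for inductions over the
  list.\<close>

fun rademacher_abs :: "real list \<Rightarrow> real \<Rightarrow> real" where
  "rademacher_abs [] u = \<bar>u\<bar>"
| "rademacher_abs (t # ts) u = (rademacher_abs ts (u + t) + rademacher_abs ts (u - t)) / 2"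

lemma even_convex_rademacher_abs: "even_convex (rademacher_abs ts)"
proof (induction ts)
  case Nil
  have "rademacher_abs [] = abs" by (rule ext) simp
  then show ?case using even_convex_abs by simp
next
  case (Cons t ts)
  have "rademacher_abs (t # ts) = (\<lambda>u. (rademacher_abs ts (u + t) + rademacher_abs ts (u - t)) / 2)"
    by (rule ext) simp
  then show ?case using even_convex_avg[OF Cons.IH, of t] by simp
qed

text \<open>The integrated form of \<open>\<bar>y\<bar> \<ge> q y\<^sup>2 - 4/27 q\<^sup>3 y\<^sup>4\<close>: the last factor bounds the fourth
  moment of \<open>u + \<Sum>\<^sub>j \<epsilon>\<^sub>j t\<^sub>j\<close> from above.\<close>

lemma rademacher_abs_moments:
  assumes "0 \<le> q"
  shows "q * (u\<^sup>2 + (\<Sum>t\<leftarrow>ts. t\<^sup>2))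
      - 4 / 27 * q ^ 3 * (u ^ 4 + 6 * u\<^sup>2 * (\<Sum>t\<leftarrow>ts. t\<^sup>2) + 3 * (\<Sum>t\<leftarrow>ts. t\<^sup>2)\<^sup>2)
    \<le> rademacher_abs ts u"
proof (induction ts arbitrary: u)
  case Nil
  define v where "v = q * \<bar>u\<bar>"
  have "0 \<le> v" using assms by (simp add: v_def)
  \<comment> \<open>The coefficient 4/27 is the one for which this cubic has a double root, at
    \<open>v = 3/2\<close>.\<close>
  have "27 - 27 * v + 4 * v ^ 3 = (2 * v - 3)\<^sup>2 * (v + 3)"
    by algebra
  moreover have "0 \<le> (2 * v - 3)\<^sup>2 * (v + 3)" using \<open>0 \<le> v\<close> by simp
  ultimately have "v - 4 / 27 * v ^ 3 \<le> 1" by simp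
  then have "\<bar>u\<bar> * (v - 4 / 27 * v ^ 3) \<le> \<bar>u\<bar> * 1" by (rule mult_left_mono) simp
  moreover have "\<bar>u\<bar> * (v - 4 / 27 * v ^ 3) = q * \<bar>u\<bar>\<^sup>2 - 4 / 27 * q ^ 3 * \<bar>u\<bar> ^ 4"
    by (simp add: v_def power2_eq_square power3_eq_cube power4_eq_xxxx algebra_simps)
  ultimately show ?case by simp
next
  case (Cons t ts)
  define s where "s = (\<Sum>t\<leftarrow>ts. t\<^sup>2)"
  define k where "k = 4 / 27 * q ^ 3"
  define F where "F u s = q * (u\<^sup>2 + s) - k * (u ^ 4 + 6 * u\<^sup>2 * s + 3 * s\<^sup>2)" for u s :: real
  have IH: "F u s \<le> rademacher_abs ts u" for u using Cons.IH[of u] unfolding F_def s_def k_def .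
  \<comment> \<open>Averaging over the new sign produces \<open>t ^ 4\<close>, whereas replacing
    \<open>s\<close> by \<open>t\<^sup>2 + s\<close> in \<open>3 * s\<^sup>2\<close> allows for
    \<open>3 * t ^ 4\<close>; all other terms agree.\<close>
  have "F (u + t) s + F (u - t) s - 2 * F u (t\<^sup>2 + s) = k * (4 * t ^ 4)"
    unfolding F_def by algebra
  moreover have "0 \<le> k * (4 * t ^ 4)" using assms by (simp add: k_def)
  ultimately have "0 \<le> F (u + t) s + F (u - t) s - 2 * F u (t\<^sup>2 + s)" by (simp only:)
  then have "F u (t\<^sup>2 + s) \<le> (F (u + t) s + F (u - t) s) / 2" by argo
  also have "\<dots> \<le> rademacher_abs (t # ts) u" using IH[of "u + t"] IH[of "u - t"] by simp
  finally show ?case unfolding F_def s_def k_def by simp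
qed

lemma khintchine: "sqrt (\<Sum>t\<leftarrow>ts. t\<^sup>2) \<le> sqrt 3 * rademacher_abs ts 0"
proof -
  define \<sigma> where "\<sigma> = sqrt (\<Sum>t\<leftarrow>ts. t\<^sup>2)"
  have nonneg: "0 \<le> (\<Sum>t\<leftarrow>ts. t\<^sup>2)" by (rule sum_list_nonneg) auto
  then have sum: "(\<Sum>t\<leftarrow>ts. t\<^sup>2) = \<sigma>\<^sup>2" by (simp add: \<sigma>_def)
  have s3: "sqrt 3 * sqrt 3 = (3::real)" by simp
  show ?thesis
  proof (cases "\<sigma> = 0")
    case True
    have "0 \<le> rademacher_abs ts 0" using rademacher_abs_moments[of 0 0 ts] by simp
    then show ?thesis using True by (simp add: \<sigma>_def)
  next
    case False
    with nonneg have pos: "\<sigma> > 0" by (simp add: \<sigma>_def order_less_le)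
    \<comment> \<open>This \<open>q\<close> maximises the moment bound at \<open>u = 0\<close>,
      namely \<open>q * \<sigma>\<^sup>2 - 4 / 9 * q ^ 3 * \<sigma> ^ 4\<close>; the maximum is
      \<open>\<sigma> / sqrt 3\<close>.\<close>
    define q where "q = sqrt 3 / (2 * \<sigma>)"
    have "q * \<sigma>\<^sup>2 - 4 / 27 * q ^ 3 * (3 * (\<sigma>\<^sup>2)\<^sup>2) \<le> rademacher_abs ts 0"
      using rademacher_abs_moments[of q 0 ts] pos by (simp add: q_def sum)
    moreover have "sqrt 3 * (q * \<sigma>\<^sup>2 - 4 / 27 * q ^ 3 * (3 * (\<sigma>\<^sup>2)\<^sup>2)) = \<sigma>"
    proof -
      have "q * \<sigma>\<^sup>2 - 4 / 27 * q ^ 3 * (3 * (\<sigma>\<^sup>2)\<^sup>2)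
          = (q * \<sigma>) * \<sigma> - 4 / 9 * (q * \<sigma>) ^ 3 * \<sigma>"
        by (simp add: power2_eq_square power3_eq_cube)
      also have "q * \<sigma> = sqrt 3 / 2" using pos by (simp add: q_def)
      finally have "sqrt 3 * (q * \<sigma>\<^sup>2 - 4 / 27 * q ^ 3 * (3 * (\<sigma>\<^sup>2)\<^sup>2))
          = (sqrt 3 * sqrt 3) / 2 * \<sigma> - (sqrt 3 * sqrt 3) * (sqrt 3 * sqrt 3) / 18 * \<sigma>"
        by (simp only: power3_eq_cube) (simp add: field_simps)
      then show ?thesis by (simp only: s3)
    qed
    ultimately have "\<sigma> \<le> sqrt 3 * rademacher_abs ts 0"
      by (metis mult_left_mono real_sqrt_ge_zero zero_le_numeral)
    then show ?thesis by (simp add: \<sigma>_def)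
  qed
qed

text \<open>Cauchy-Schwarz against the constant vector.\<close>

lemma sum_list_le_sqrt_length: "sum_list ts \<le> sqrt (real (length ts)) * sqrt (\<Sum>t\<leftarrow>ts. t\<^sup>2)"
  for ts :: "real list"
proof -
  have "(sum_list ts)\<^sup>2 \<le> real (length ts) * (\<Sum>t\<leftarrow>ts. t\<^sup>2)"
    using sum_squared_le_sum_of_squares[of "\<lambda>i. ts ! i" "{0..<length ts}"]
    by (simp add: sum_list_sum_nth mult.commute)
  then show ?thesis
    by (simp add: real_le_rsqrt flip: real_sqrt_mult)
qed

section \<open>Elementary inequalities for sinh and cosh\<close>

lemma abs_sinh_le_cosh: "\<bar>sinh x\<bar> \<le> cosh (x :: real)"
  using sinh_le_cosh_real[of x] sinh_le_cosh_real[of "- x"] by simp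

lemma cosh_le_1_plus_abs_sinh: "cosh x \<le> 1 + \<bar>sinh x\<bar>" for x :: real
proof (rule power2_le_imp_le)
  have "(1 + \<bar>sinh x\<bar>)\<^sup>2 = 1 + 2 * \<bar>sinh x\<bar> + (sinh x)\<^sup>2"
    by (simp add: power2_sum)
  then show "(cosh x)\<^sup>2 \<le> (1 + \<bar>sinh x\<bar>)\<^sup>2" by (simp add: cosh_square_eq)
qed simp

lemma abs_sinh_add_le: "\<bar>sinh (u + x)\<bar> \<le> \<bar>sinh u\<bar> * cosh x + cosh u * \<bar>sinh x\<bar>" for u x :: real
  using abs_triangle_ineq[of "sinh u * cosh x" "cosh u * sinh x"]
  by (simp add: sinh_add abs_mult)

section \<open>Convolutions indexed by multisets\<close>

locale admissible_family =
  fixes \<eta> :: "nat \<Rightarrow> real \<Rightarrow> real"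
  assumes adm: "admissible (\<eta> i)"
begin

text \<open>\<open>mint M f\<close> is the integral of \<open>f\<close> against the convolution of the \<open>\<eta> i\<close>, \<open>i \<in># M\<close>; indexing by
  multisets builds in the commutativity of convolution.\<close>

definition integrate_step :: "nat \<Rightarrow> ((real \<Rightarrow> real) \<Rightarrow> real) \<Rightarrow> (real \<Rightarrow> real) \<Rightarrow> real" where
  "integrate_step i \<Phi> f = fm_integral (\<eta> i) (\<lambda>x. \<Phi> (\<lambda>y. f (x + y)))"

text \<open>Finite sums may be interchanged, so the fold over a multiset does not depend on the
  order of integration.\<close>

sublocale integrate_step: comp_fun_commute integrate_step
proof
  fix i j
  show "integrate_step j \<circ> integrate_step i = integrate_step i \<circ> integrate_step j"
  proof (intro ext)
    fix \<Phi> f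
    show "(integrate_step j \<circ> integrate_step i) \<Phi> f = (integrate_step i \<circ> integrate_step j) \<Phi> f"
      unfolding integrate_step_def fm_integral_def o_def sum_distrib_left
      by (subst sum.swap) (simp add: mult.left_commute add.left_commute)
  qed
qed

definition mint :: "nat multiset \<Rightarrow> (real \<Rightarrow> real) \<Rightarrow> real" where
  "mint M = fold_mset integrate_step (\<lambda>f. f 0) M"

lemma mint_empty [simp]: "mint {#} f = f 0"
  by (simp add: mint_def)

lemma mint_add_mset: "mint (add_mset i M) f = fm_integral (\<eta> i) (\<lambda>x. mint M (\<lambda>y. f (x + y)))"
  by (simp add: mint_def integrate_step_def)

lemma fin_pos: "fin_pos_measure (\<eta> i)"
  using adm by (simp add: admissible_def)

lemma mint_add: "mint M (\<lambda>x. f x + g x) = mint M f + mint M g"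
  by (induction M arbitrary: f g) (simp_all add: mint_add_mset fm_integral_add)

lemma mint_cmult: "mint M (\<lambda>x. c * f x) = c * mint M f"
  by (induction M arbitrary: f) (simp_all add: mint_add_mset fm_integral_cmult)

lemma mint_mono: "(\<And>x. f x \<le> g x) \<Longrightarrow> mint M f \<le> mint M g"
  by (induction M arbitrary: f g) (simp_all add: mint_add_mset fm_integral_mono fin_pos)

lemma mint_divide: "mint M (\<lambda>x. f x / c) = mint M f / c"
  using mint_cmult[of M "1 / c" f] by simp

lemma mint_const: "mint M (\<lambda>x. c) = c * mint M (\<lambda>x. 1)"
  using mint_cmult[of M c "\<lambda>x. 1"] by simp

lemma mint_union: "mint (M + N) f = mint M (\<lambda>x. mint N (\<lambda>y. f (x + y)))"
  by (induction M arbitrary: f) (simp_all add: mint_add_mset add.assoc)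

text \<open>In the addition formulas each \<open>\<eta> i\<close> integrates \<open>cosh\<close> to
  1 and \<open>sinh\<close> to 0, so every convolution reproduces both functions.\<close>

lemma mint_cosh: "mint M (\<lambda>x. cosh (u + x)) = cosh u"
  and mint_sinh: "mint M (\<lambda>x. sinh (u + x)) = sinh u"
proof (induction M arbitrary: u)
  case (add i M)
  {
    case 1
    have "mint (add_mset i M) (\<lambda>x. cosh (u + x))
        = fm_integral (\<eta> i) (\<lambda>x. cosh u * cosh x + sinh u * sinh x)"
      using add(1) by (simp add: mint_add_mset flip: add.assoc) (simp add: cosh_add)
    then show ?case
      by (simp add: fm_integral_add fm_integral_cmult admissible_cosh[OF adm] admissible_sinh[OF adm])
  next
    case 2
    have "mint (add_mset i M) (\<lambda>x. sinh (u + x))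
        = fm_integral (\<eta> i) (\<lambda>x. sinh u * cosh x + cosh u * sinh x)"
      using add(2) by (simp add: mint_add_mset flip: add.assoc) (simp add: sinh_add)
    then show ?case
      by (simp add: fm_integral_add fm_integral_cmult admissible_cosh[OF adm] admissible_sinh[OF adm])
  }
qed simp_all

section \<open>The functional \<tau> and the total mass\<close>

definition \<tau> :: "nat multiset \<Rightarrow> real" where
  "\<tau> M = mint M (\<lambda>x. \<bar>sinh x\<bar>)"

text \<open>Tracked separately because admissibility normalises the integral of \<open>cosh\<close>,
  not that of 1.\<close>

definition mass :: "nat multiset \<Rightarrow> real" where
  "mass M = mint M (\<lambda>x. 1)"

lemma mint_nonneg: "(\<And>x. 0 \<le> f x) \<Longrightarrow> 0 \<le> mint M f"
  using mint_mono[of "\<lambda>x. 0" f M] mint_cmult[of M 0 "\<lambda>x. 0"] by simp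

lemma \<tau>_nonneg: "0 \<le> \<tau> M"
  by (simp add: \<tau>_def mint_nonneg)

lemma mass_nonneg: "0 \<le> mass M"
  by (simp add: mass_def mint_nonneg)

lemma \<tau>_empty [simp]: "\<tau> {#} = 0"
  by (simp add: \<tau>_def)

lemma mass_empty [simp]: "mass {#} = 1"
  by (simp add: mass_def)

lemma mass_union: "mass (M + N) = mass M * mass N"
  using mint_const[of M "mass N"] by (simp add: mass_def mint_union)

lemma mint_cosh0: "mint M cosh = 1"
  using mint_cosh[of M 0] by simp

lemma mass_le_1: "mass M \<le> 1"
proof -
  have "mint M (\<lambda>x. 1) \<le> mint M cosh" by (rule mint_mono) (rule cosh_real_ge_1)
  then show ?thesis by (simp add: mass_def mint_cosh0)
qed

lemma \<tau>_le_1: "\<tau> M \<le> 1"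
proof -
  have "mint M (\<lambda>x. \<bar>sinh x\<bar>) \<le> mint M cosh" by (rule mint_mono) (rule abs_sinh_le_cosh)
  then show ?thesis by (simp add: \<tau>_def mint_cosh0)
qed

lemma mass_ge: "1 - \<tau> M \<le> mass M"
proof -
  have "mint M cosh \<le> mint M (\<lambda>x. 1 + \<bar>sinh x\<bar>)"
    by (rule mint_mono) (rule cosh_le_1_plus_abs_sinh)
  then show ?thesis by (simp add: mint_cosh0 mint_add \<tau>_def mass_def)
qed

lemma mint_abs_sinh_shift_le: "mint M (\<lambda>x. \<bar>sinh (u + x)\<bar>) \<le> \<bar>sinh u\<bar> + cosh u * \<tau> M"
  and mint_abs_sinh_diff_le: "mint M (\<lambda>x. \<bar>sinh (u - x)\<bar>) \<le> \<bar>sinh u\<bar> + cosh u * \<tau> M"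
proof -
  have "mint M f \<le> \<bar>sinh u\<bar> + cosh u * \<tau> M"
    if "\<And>x. f x \<le> \<bar>sinh u\<bar> * cosh x + cosh u * \<bar>sinh x\<bar>" for f
    using mint_mono[of f _ M, OF that] by (simp add: mint_add mint_cmult mint_cosh0 \<tau>_def)
  then show "mint M (\<lambda>x. \<bar>sinh (u + x)\<bar>) \<le> \<bar>sinh u\<bar> + cosh u * \<tau> M"
    and "mint M (\<lambda>x. \<bar>sinh (u - x)\<bar>) \<le> \<bar>sinh u\<bar> + cosh u * \<tau> M"
    using abs_sinh_add_le[of u] abs_sinh_add_le[of u "- _"] by simp_all
qed

lemma \<tau>_union_le: "\<tau> (M + N) \<le> \<tau> M + \<tau> N"
proof -
  have "\<tau> (M + N) \<le> mint M (\<lambda>x. \<bar>sinh x\<bar> + \<tau> N * cosh x)"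
    unfolding \<tau>_def[of "M + N"] mint_union
    by (rule mint_mono) (subst mult.commute, rule mint_abs_sinh_shift_le)
  then show ?thesis by (simp add: mint_add mint_cmult mint_cosh0 \<tau>_def)
qed

lemma mint_abs_le: "\<bar>mint M f\<bar> \<le> mint M (\<lambda>x. \<bar>f x\<bar>)"
proof -
  have "mint M f \<le> mint M (\<lambda>x. \<bar>f x\<bar>)" by (rule mint_mono) simp
  moreover have "mint M (\<lambda>x. (- 1) * f x) \<le> mint M (\<lambda>x. \<bar>f x\<bar>)" by (rule mint_mono) simp
  ultimately show ?thesis unfolding mint_cmult by simp
qed

text \<open>Integration over \<open>N\<close> reproduces \<open>sinh\<close>, so
  \<open>\<bar>sinh x\<bar>\<close> is the modulus of an integral and at most the integral of the
  modulus.\<close>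

lemma \<tau>_le_union: "\<tau> M \<le> \<tau> (M + N)"
  unfolding \<tau>_def mint_union
proof (rule mint_mono)
  fix x
  show "\<bar>sinh x\<bar> \<le> mint N (\<lambda>y. \<bar>sinh (x + y)\<bar>)"
    using mint_abs_le[of N "\<lambda>y. sinh (x + y)"] by (simp add: mint_sinh)
qed

lemma \<tau>_mono: "M \<subseteq># N \<Longrightarrow> \<tau> M \<le> \<tau> N"
  by (metis \<tau>_le_union subset_mset.add_diff_inverse)

section \<open>Symmetrisation over disjoint blocks\<close>

lemma mint_sum: "mint M (\<lambda>x. \<Sum>y\<in>S. h y x) = (\<Sum>y\<in>S. mint M (h y))"
  using mint_cmult[of M 0 "\<lambda>x. 0"]
  by (induction S rule: infinite_finite_induct) (simp_all add: mint_add)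

lemma mint_swap: "mint M (\<lambda>x. mint N (\<lambda>y. g x y)) = mint N (\<lambda>y. mint M (\<lambda>x. g x y))"
proof (induction M arbitrary: g)
  case empty
  show ?case by simp
next
  case (add i M)
  have "mint (add_mset i M) (\<lambda>x. mint N (\<lambda>y. g x y))
      = fm_integral (\<eta> i) (\<lambda>z. mint N (\<lambda>y. mint M (\<lambda>x. g (z + x) y)))"
    by (simp add: mint_add_mset add)
  also have "\<dots> = mint N (\<lambda>y. mint (add_mset i M) (\<lambda>x. g x y))"
    by (simp add: mint_add_mset fm_integral_def mint_sum mint_cmult)
  finally show ?case .
qed

text \<open>\<open>sym L u\<close> is the mean of \<open>\<bar>sinh (u + \<Sum>\<^sub>j \<epsilon>\<^sub>j x\<^sub>j)\<bar>\<close> over independent random signs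
  \<open>\<epsilon>\<^sub>j\<close>, with \<open>x\<^sub>j\<close> integrated over the convolution belonging to the \<open>j\<close>-th block.\<close>

fun sym :: "nat multiset list \<Rightarrow> real \<Rightarrow> real" where
  "sym [] u = \<bar>sinh u\<bar>"
| "sym (M # L) u = mint M (\<lambda>x. (sym L (u + x) + sym L (u - x)) / 2)"

text \<open>For fixed signs, the blocks with sign \<open>+\<close> and those with sign \<open>-\<close> contribute at most
  \<open>\<tau>\<close> of their union each.\<close>

lemma sym_le_aux: "mint A (\<lambda>a. mint B (\<lambda>b. sym L (a - b))) \<le> 2 * \<tau> (A + B + sum_list L)"
proof (induction L arbitrary: A B)
  case Nil
  have "mint A (\<lambda>a. mint B (\<lambda>b. sym [] (a - b))) \<le> mint A (\<lambda>a. \<bar>sinh a\<bar> + \<tau> B * cosh a)"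
    by (rule mint_mono) (simp add: mult.commute[of "\<tau> B"] mint_abs_sinh_diff_le)
  also have "\<dots> = \<tau> A + \<tau> B" by (simp add: mint_add mint_cmult mint_cosh0 \<tau>_def)
  also have "\<dots> \<le> 2 * \<tau> (A + B)"
    using \<tau>_le_union[of A B] \<tau>_le_union[of B A] by (simp add: add.commute)
  finally show ?case by simp
next
  case (Cons M L)
  \<comment> \<open>The sign of the block \<open>M\<close> decides which side it joins:
    \<open>A\<close> for plus, \<open>B\<close> for minus.\<close>
  have 1: "mint A (\<lambda>a. mint B (\<lambda>b. mint M (\<lambda>x. sym L (a - b + x))))
      = mint (A + M) (\<lambda>a. mint B (\<lambda>b. sym L (a - b)))"
    by (simp add: mint_union mint_swap[of B M] algebra_simps)
  have 2: "mint A (\<lambda>a. mint B (\<lambda>b. mint M (\<lambda>x. sym L (a - b - x))))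
      = mint A (\<lambda>a. mint (B + M) (\<lambda>b. sym L (a - b)))"
    by (simp add: mint_union algebra_simps)
  have "mint A (\<lambda>a. mint B (\<lambda>b. sym (M # L) (a - b)))
      = (mint (A + M) (\<lambda>a. mint B (\<lambda>b. sym L (a - b)))
        + mint A (\<lambda>a. mint (B + M) (\<lambda>b. sym L (a - b)))) / 2"
    unfolding 1[symmetric] 2[symmetric] by (simp add: mint_divide mint_add)
  with Cons.IH[of "A + M" B] Cons.IH[of A "B + M"] show ?case
    by (simp add: ac_simps)
qed

lemma sym_le: "sym L 0 \<le> 2 * \<tau> (sum_list L)"
  using sym_le_aux[of "{#}" "{#}" L] by simp

text \<open>Integrate the supporting line at \<open>\<tau> M\<close>. As the mass may be below 1, a
  term \<open>c * \<tau> M * (1 - mass M)\<close> is left over; a slope \<open>c \<ge> 0\<close>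
  gives it the right sign.\<close>

lemma mint_jensen:
  assumes "even_convex \<phi>"
  shows "mass M * \<phi> (\<tau> M) \<le> mint M (\<lambda>x. \<phi> \<bar>sinh x\<bar>)"
proof -
  obtain c where c: "0 \<le> c" "\<And>s. \<phi> (\<tau> M) + c * (s - \<tau> M) \<le> \<phi> s"
    using even_convex_support_nonneg[OF assms \<tau>_nonneg] by blast
  have "\<phi> (\<tau> M) - c * \<tau> M + c * s \<le> \<phi> s" for s
    using c(2)[of s] by (simp add: algebra_simps)
  then have "mint M (\<lambda>x. (\<phi> (\<tau> M) - c * \<tau> M) + c * \<bar>sinh x\<bar>) \<le> mint M (\<lambda>x. \<phi> \<bar>sinh x\<bar>)"
    by (intro mint_mono)
  moreover have "mint M (\<lambda>x. (\<phi> (\<tau> M) - c * \<tau> M) + c * \<bar>sinh x\<bar>)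
      = (\<phi> (\<tau> M) - c * \<tau> M) * mass M + c * \<tau> M"
    unfolding mint_add mint_cmult mint_const[of M "\<phi> (\<tau> M) - c * \<tau> M"]
    by (simp add: mass_def \<tau>_def)
  moreover have "0 \<le> c * \<tau> M * (1 - mass M)"
    using c(1) \<tau>_nonneg mass_le_1 by simp
  ultimately show ?thesis by (simp add: algebra_simps)
qed

text \<open>In \<open>sinh (u \<plusminus> x) = sinh u * cosh x \<plusminus> cosh u * sinh x\<close>
  both factors \<open>cosh\<close> are at least 1, and dropping them can only lower a symmetric
  average of an even convex function. Jensen's inequality then replaces
  \<open>\<bar>sinh x\<bar>\<close> by \<open>\<tau> M\<close>, one block at a time.\<close>

lemma sym_ge:
  "mass (sum_list L) * rademacher_abs (map \<tau> L) (sinh u) \<le> sym L u"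
proof (induction L arbitrary: u)
  case Nil
  show ?case by simp
next
  case (Cons M L)
  define V where "V = rademacher_abs (map \<tau> L)"
  define b where "b = mass (sum_list L)"
  define \<phi> where "\<phi> s = (V (s + sinh u) + V (s - sinh u)) / 2" for s
  have V: "even_convex V" by (simp add: V_def even_convex_rademacher_abs)
  have \<phi>: "even_convex \<phi>" unfolding \<phi>_def by (rule even_convex_avg[OF V])
  have b: "0 \<le> b" by (simp add: b_def mass_nonneg)
  have IH: "b * V (sinh u) \<le> sym L u" for u using Cons.IH by (simp add: b_def V_def)
  have "b * \<phi> \<bar>sinh x\<bar> \<le> (sym L (u + x) + sym L (u - x)) / 2" for x
  proof -
    have "\<phi> \<bar>sinh x\<bar> = (V (sinh u + \<bar>sinh x\<bar>) + V (sinh u - \<bar>sinh x\<bar>)) / 2"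
      unfolding \<phi>_def by (rule even_convex_avg_swap[OF V])
    also have "\<dots> \<le> (V (sinh u * cosh x + cosh u * sinh x) + V (sinh u * cosh x - cosh u * sinh x)) / 2"
    proof (rule even_convex_avg_mono[OF V])
      have "\<bar>sinh u\<bar> * 1 \<le> \<bar>sinh u\<bar> * cosh x" by (rule mult_left_mono) (simp_all add: cosh_real_ge_1)
      then show "\<bar>sinh u\<bar> \<le> \<bar>sinh u * cosh x\<bar>" by (simp add: abs_mult)
      have "1 * \<bar>sinh x\<bar> \<le> cosh u * \<bar>sinh x\<bar>" by (rule mult_right_mono) (simp_all add: cosh_real_ge_1)
      then show "\<bar>\<bar>sinh x\<bar>\<bar> \<le> \<bar>cosh u * sinh x\<bar>" by (simp add: abs_mult)
    qed
    also have "\<dots> = (V (sinh (u + x)) + V (sinh (u - x))) / 2"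
      by (simp add: sinh_add sinh_diff)
    finally have "b * \<phi> \<bar>sinh x\<bar> \<le> b * ((V (sinh (u + x)) + V (sinh (u - x))) / 2)"
      using b by (rule mult_left_mono)
    also have "\<dots> = (b * V (sinh (u + x)) + b * V (sinh (u - x))) / 2"
      by (simp add: algebra_simps)
    finally show ?thesis using IH[of "u + x"] IH[of "u - x"] by argo
  qed
  then have "mint M (\<lambda>x. b * \<phi> \<bar>sinh x\<bar>) \<le> sym (M # L) u"
    unfolding sym.simps by (rule mint_mono)
  moreover have "b * (mass M * \<phi> (\<tau> M)) \<le> mint M (\<lambda>x. b * \<phi> \<bar>sinh x\<bar>)"
    unfolding mint_cmult by (rule mult_left_mono[OF mint_jensen[OF \<phi>] b])
  moreover have "\<phi> (\<tau> M) = rademacher_abs (map \<tau> (M # L)) (sinh u)"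
    unfolding \<phi>_def by (subst even_convex_avg_swap[OF V]) (simp add: V_def)
  ultimately show ?case
    by (simp add: mass_union b_def mult.assoc mult.left_commute)
qed

text \<open>The two bounds on \<open>sym L 0\<close>, with \<open>mass_ge\<close>, give
  \<open>(1 - \<delta>) * r \<le> 2 * \<delta>\<close> for the Rademacher average \<open>r\<close>.
  Khintchine and Cauchy-Schwarz pass from \<open>r\<close> to the sum.\<close>

lemma sum_blocks_le:
  "(1 - \<tau> (sum_list L)) * (\<Sum>M\<leftarrow>L. \<tau> M)
    \<le> 2 * sqrt 3 * sqrt (real (length L)) * \<tau> (sum_list L)"
proof -
  define r where "r = rademacher_abs (map \<tau> L) 0"
  define \<delta> where "\<delta> = \<tau> (sum_list L)"
  have r: "(\<Sum>M\<leftarrow>L. \<tau> M) \<le> sqrt (real (length L)) * (sqrt 3 * r)"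
    using sum_list_le_sqrt_length[of "map \<tau> L"] khintchine[of "map \<tau> L"]
    by (simp add: r_def) (meson mult_left_mono order_trans real_sqrt_ge_zero of_nat_0_le_iff)
  have "0 \<le> rademacher_abs (map \<tau> L) 0"
    using rademacher_abs_moments[of 0 0 "map \<tau> L"] by simp
  then have "(1 - \<delta>) * r \<le> mass (sum_list L) * r"
    using mass_ge by (simp add: \<delta>_def r_def mult_right_mono)
  also have "\<dots> \<le> 2 * \<delta>" using sym_ge[of L 0] sym_le[of L] by (simp add: r_def \<delta>_def)
  finally have *: "(1 - \<delta>) * r \<le> 2 * \<delta>" .
  have "0 \<le> 1 - \<delta>" using \<tau>_le_1 by (simp add: \<delta>_def)
  then have "(1 - \<delta>) * (\<Sum>M\<leftarrow>L. \<tau> M) \<le> (1 - \<delta>) * (sqrt (real (length L)) * (sqrt 3 * r))"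
    using r by (rule mult_left_mono[rotated])
  also have "\<dots> = sqrt (real (length L)) * sqrt 3 * ((1 - \<delta>) * r)" by simp
  also have "\<dots> \<le> sqrt (real (length L)) * sqrt 3 * (2 * \<delta>)"
    using * by (rule mult_left_mono) simp
  finally show ?thesis by (simp add: \<delta>_def mult_ac)
qed

lemma \<tau>_sum_le: "\<tau> (\<Sum>k\<in>K. M k) \<le> (\<Sum>k\<in>K. \<tau> (M k))"
proof (induction K rule: infinite_finite_induct)
  case (insert k K)
  then show ?case using \<tau>_union_le[of "M k" "\<Sum>k\<in>K. M k"] by simp
qed simp_all

end

section \<open>Averaging over permutations and words\<close>

lemma permutes_extending_equal_card:
  assumes "finite S" "A \<subseteq> S" "B \<subseteq> S" "card A = card B"
  shows "\<exists>p. p permutes S \<and> p ` A = B"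
proof -
  have fin: "finite A" "finite B" using assms finite_subset by auto
  obtain f where f: "bij_betw f A B"
    using finite_same_card_bij[OF fin assms(4)] by blast
  have "card (S - A) = card (S - B)" using assms fin by (simp add: card_Diff_subset)
  then obtain g where g: "bij_betw g (S - A) (S - B)"
    using finite_same_card_bij[of "S - A" "S - B"] assms(1) by blast
  define p where "p x = (if x \<in> A then f x else if x \<in> S then g x else x)" for x
  have pA: "bij_betw p A B"
    using f by (subst bij_betw_cong[of A p f]) (auto simp: p_def)
  have "bij_betw p (S - A) (S - B)"
    using g by (subst bij_betw_cong[of "S - A" p g]) (auto simp: p_def)
  with pA have "bij_betw p (A \<union> (S - A)) (B \<union> (S - B))"
    by (rule bij_betw_combine) auto
  then have "bij_betw p S S" using assms by (simp add: Un_absorb1)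
  then have "p permutes S"
    by (rule bij_imp_permutes) (use assms in \<open>auto simp: p_def\<close>)
  with pA show ?thesis by (auto simp: bij_betw_def)
qed

context admissible_family begin

text \<open>Composing with a permutation that carries \<open>A\<close> to \<open>B\<close> only
  reorders the sum.\<close>

lemma perm_sum_card:
  assumes "A \<subseteq> {..<n}" "B \<subseteq> {..<n}" "card A = card B"
  shows "(\<Sum>\<sigma> | \<sigma> permutes {..<n}. \<tau> (image_mset \<sigma> (mset_set A)))
       = (\<Sum>\<sigma> | \<sigma> permutes {..<n}. \<tau> (image_mset \<sigma> (mset_set B)))"
proof -
  obtain p where p: "p permutes {..<n}" "p ` A = B"
    using permutes_extending_equal_card[of "{..<n}" A B] assms by auto
  have "image_mset p (mset_set A) = mset_set B"
    using p permutes_inj_on[OF p(1)] by (simp add: image_mset_mset_set)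
  then have eq: "image_mset (\<sigma> \<circ> p) (mset_set A) = image_mset \<sigma> (mset_set B)" for \<sigma> :: "nat \<Rightarrow> nat"
    by (metis multiset.map_comp)
  show ?thesis
    by (subst sum_permutations_compose_right[OF p(1), of "\<lambda>\<sigma>. \<tau> (image_mset \<sigma> (mset_set A))"]) (simp only: eq)
qed

text \<open>Consecutive intervals of length \<open>card A\<close> fit \<open>m\<close> times into
  \<open>{..<n}\<close>. The block bound holds for their images under each permutation, and after
  summation over all permutations every interval contributes as much as \<open>A\<close>.\<close>

lemma perm_sum_blocks_le:
  fixes n
  defines "\<delta> \<equiv> \<tau> (mset_set {..<n})"
  assumes A: "A \<subseteq> {..<n}" and m: "m * card A \<le> n" "m > 0"
  shows "(1 - \<delta>) * sqrt (real m) * (\<Sum>\<sigma> | \<sigma> permutes {..<n}. \<tau> (image_mset \<sigma> (mset_set A)))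
    \<le> 2 * sqrt 3 * \<delta> * fact n"
proof -
  define a where "a = card A"
  define B where "B j = {j * a..<Suc j * a}" for j
  define P where "P = {\<sigma>. \<sigma> permutes {..<n}}"
  define G where "G = (\<Sum>\<sigma>\<in>P. \<tau> (image_mset \<sigma> (mset_set A)))"
  have P: "finite P" "card P = fact n"
    by (simp_all add: P_def finite_permutations card_permutations)
  have Bsum: "(\<Sum>j<k. mset_set (B j)) = mset_set {..<k * a}" for k
  proof (induction k)
    case (Suc k)
    have "{..<Suc k * a} = {..<k * a} \<union> B k" by (auto simp: B_def)
    moreover have "mset_set ({..<k * a} \<union> B k) = mset_set {..<k * a} + mset_set (B k)"
      by (rule mset_set_Union) (auto simp: B_def)
    ultimately show ?case using Suc.IH by simp
  qed simp
  have block: "(1 - \<delta>) * (\<Sum>j<m. \<tau> (image_mset \<sigma> (mset_set (B j)))) \<le> 2 * sqrt 3 * sqrt (real m) * \<delta>"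
    if "\<sigma> \<in> P" for \<sigma>
  proof -
    define L where "L = map (\<lambda>j. image_mset \<sigma> (mset_set (B j))) [0..<m]"
    have "sum_list L = (\<Sum>j<m. image_mset \<sigma> (mset_set (B j)))"
      by (simp add: L_def interv_sum_list_conv_sum_set_nat lessThan_atLeast0)
    also have "\<dots> = image_mset \<sigma> (\<Sum>j<m. mset_set (B j))"
      by (induction m) simp_all
    also have "\<dots> = image_mset \<sigma> (mset_set {..<m * a})" by (simp only: Bsum)
    \<comment> \<open>The intervals need not exhaust \<open>{..<n}\<close>; monotonicity of \<tau>
      makes up for the rest.\<close>
    also have "\<dots> \<subseteq># image_mset \<sigma> (mset_set {..<n})"
      using m(1) by (intro image_mset_subseteq_mono subset_imp_msubset_mset_set) (auto simp: a_def)
    also have "\<dots> = mset_set {..<n}"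
      using that by (simp add: P_def permutes_image image_mset_mset_set permutes_inj_on)
    finally have le: "\<tau> (sum_list L) \<le> \<delta>" unfolding \<delta>_def by (rule \<tau>_mono)
    have S: "(\<Sum>M\<leftarrow>L. \<tau> M) = (\<Sum>j<m. \<tau> (image_mset \<sigma> (mset_set (B j))))"
      by (simp add: L_def interv_sum_list_conv_sum_set_nat lessThan_atLeast0 o_def)
    have "(1 - \<delta>) * (\<Sum>M\<leftarrow>L. \<tau> M) \<le> (1 - \<tau> (sum_list L)) * (\<Sum>M\<leftarrow>L. \<tau> M)"
      using le by (intro mult_right_mono sum_list_nonneg) (auto simp: \<tau>_nonneg)
    also have "\<dots> \<le> 2 * sqrt 3 * sqrt (real m) * \<tau> (sum_list L)"
      using sum_blocks_le[of L] by (simp add: L_def)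
    also have "\<dots> \<le> 2 * sqrt 3 * sqrt (real m) * \<delta>"
      using le by (intro mult_left_mono) auto
    finally show ?thesis unfolding S .
  qed
  have "real m * G = (\<Sum>j<m. \<Sum>\<sigma>\<in>P. \<tau> (image_mset \<sigma> (mset_set (B j))))"
  proof -
    have "(\<Sum>\<sigma>\<in>P. \<tau> (image_mset \<sigma> (mset_set (B j)))) = G" if "j < m" for j
    proof -
      have "Suc j * a \<le> m * a" using that by (intro mult_le_mono1) simp
      then have "B j \<subseteq> {..<n}" using m(1) unfolding a_def[symmetric] by (auto simp: B_def)
      moreover have "card (B j) = card A" by (simp add: B_def a_def)
      ultimately show ?thesis using perm_sum_card[OF A, of "B j"] by (simp add: G_def P_def)
    qed
    then show ?thesis by simp
  qed
  also have "\<dots> = (\<Sum>\<sigma>\<in>P. \<Sum>j<m. \<tau> (image_mset \<sigma> (mset_set (B j))))" by (rule sum.swap)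
  finally have "(1 - \<delta>) * (real m * G)
      = (\<Sum>\<sigma>\<in>P. (1 - \<delta>) * (\<Sum>j<m. \<tau> (image_mset \<sigma> (mset_set (B j)))))"
    by (simp add: sum_distrib_left)
  also have "\<dots> \<le> (\<Sum>\<sigma>\<in>P. 2 * sqrt 3 * sqrt (real m) * \<delta>)" by (intro sum_mono block)
  also have "\<dots> = sqrt (real m) * (2 * sqrt 3 * \<delta> * fact n)" using P by simp
  also have "(1 - \<delta>) * (real m * G) = (1 - \<delta>) * ((sqrt (real m) * sqrt (real m)) * G)" by simp
  also have "\<dots> = sqrt (real m) * ((1 - \<delta>) * sqrt (real m) * G)" by (simp only: mult_ac)
  finally have "sqrt (real m) * ((1 - \<delta>) * sqrt (real m) * G) \<le> sqrt (real m) * (2 * sqrt 3 * \<delta> * fact n)" .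
  then show ?thesis using m(2) by (simp add: G_def P_def)
qed

text \<open>Use as many blocks as fit, \<open>m = n div a\<close>. From \<open>m \<ge> 3\<close>
  follows \<open>n \<le> (m + 1) * a \<le> 4 / 3 * m * a\<close>, hence
  \<open>2 * sqrt 3 / sqrt m \<le> 4 * sqrt (a / n)\<close>.\<close>

lemma perm_sum_le:
  fixes n
  defines "\<delta> \<equiv> \<tau> (mset_set {..<n})"
  assumes A: "A \<subseteq> {..<n}" "3 * card A \<le> n"
  shows "(1 - \<delta>) * (\<Sum>\<sigma> | \<sigma> permutes {..<n}. \<tau> (image_mset \<sigma> (mset_set A)))
    \<le> 4 * sqrt (card A / n) * \<delta> * fact n"
proof (cases "card A = 0")
  case True
  then have "A = {}" using finite_subset[OF A(1)] by simp
  then show ?thesis by simp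
next
  case False
  define G where "G = (\<Sum>\<sigma> | \<sigma> permutes {..<n}. \<tau> (image_mset \<sigma> (mset_set A)))"
  define a where "a = card A"
  define m where "m = n div a"
  have a: "0 < a" and n: "0 < n" using False A(2) by (auto simp: a_def)
  have ma: "m * a \<le> n" by (simp add: m_def)
  have m3: "3 \<le> m" using A(2) a unfolding m_def a_def[symmetric] by (simp add: less_eq_div_iff_mult_less_eq)
  have "n < Suc m * a" using a by (simp add: m_def dividend_less_div_times)
  then have "3 * n \<le> 3 * m * a + 3 * a" by simp
  also have "3 * a \<le> m * a" using m3 by simp
  finally have "3 * n \<le> 4 * (m * a)" by (simp add: mult.commute)
  then have "real (3 * n) \<le> real (4 * (m * a))" by (simp only: of_nat_le_iff)
  then have "(2 * sqrt 3)\<^sup>2 \<le> (4 * sqrt (a / n) * sqrt m)\<^sup>2"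
    using n by (simp add: power_mult_distrib field_simps)
  then have *: "2 * sqrt 3 \<le> 4 * sqrt (a / n) * sqrt m"
    by (rule power2_le_imp_le) simp
  have \<delta>: "0 \<le> \<delta>" by (simp add: \<delta>_def \<tau>_nonneg)
  have "sqrt m * ((1 - \<delta>) * G) \<le> 2 * sqrt 3 * (\<delta> * fact n)"
    using perm_sum_blocks_le[OF A(1), of m] ma m3 by (simp add: \<delta>_def G_def a_def mult_ac)
  also have "\<dots> \<le> (4 * sqrt (a / n) * sqrt m) * (\<delta> * fact n)"
    using * \<delta> by (intro mult_right_mono) auto
  finally have "sqrt m * ((1 - \<delta>) * G) \<le> sqrt m * (4 * sqrt (a / n) * \<delta> * fact n)"
    by (simp add: mult_ac)
  then show ?thesis using m3 by (simp add: G_def a_def)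
qed

end

section \<open>Words and their letter counts\<close>

definition words :: "nat \<Rightarrow> nat \<Rightarrow> nat list set" where
  "words n l = {xs. set xs \<subseteq> {..<n} \<and> length xs = l}"

lemma words_0 [simp]: "words n 0 = {[]}"
  by (auto simp: words_def)

lemma finite_words [simp]: "finite (words n l)"
  by (simp add: words_def finite_lists_length_eq)

lemma card_words [simp]: "card (words n l) = n ^ l"
  by (simp add: words_def card_lists_length_eq)

lemma sum_words_Suc: "(\<Sum>xs\<in>words n (Suc l). g xs) = (\<Sum>i<n. \<Sum>xs\<in>words n l. g (i # xs))"
proof -
  have "words n (Suc l) = (\<lambda>(i, xs). i # xs) ` ({..<n} \<times> words n l)"
    by (auto simp: words_def image_iff length_Suc_conv)
  moreover have "inj_on (\<lambda>(i, xs). i # xs) ({..<n} \<times> words n l)"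
    by (auto simp: inj_on_def)
  ultimately show ?thesis by (simp add: sum.reindex sum.cartesian_product split_def)
qed

lemma sum_words_map:
  assumes "\<sigma> permutes {..<n}"
  shows "(\<Sum>xs\<in>words n l. h (map \<sigma> xs)) = (\<Sum>xs\<in>words n l. h xs)"
proof (rule sum.reindex_bij_betw)
  have inv: "inv \<sigma> permutes {..<n}" by (rule permutes_inv[OF assms])
  show "bij_betw (map \<sigma>) (words n l) (words n l)"
    by (rule bij_betw_byWitness[where f' = "map (inv \<sigma>)"])
      (use permutes_in_image[OF assms] permutes_in_image[OF inv] permutes_inverses[OF assms]
        in \<open>auto simp: words_def o_def subset_iff\<close>)
qed

text \<open>Double counting: \<open>k\<close> of the \<open>l\<close> positions are reserved for the
  letter \<open>i\<close>, the others are free. The induction splits off the first letter and uses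
  Pascal's rule.\<close>

lemma sum_words_choose:
  assumes "i < n"
  shows "n ^ k * (\<Sum>xs\<in>words n l. count (mset xs) i choose k) = (l choose k) * n ^ l"
proof (induction l arbitrary: k)
  case 0
  show ?case by (cases k) simp_all
next
  case (Suc l)
  show ?case
  proof (cases k)
    case 0
    then show ?thesis by simp
  next
    case (Suc k')
    define E where "E k = (\<Sum>xs\<in>words n l. count (mset xs) i choose k)" for k
    have "(\<Sum>xs\<in>words n (Suc l). count (mset xs) i choose Suc k')
        = (\<Sum>j<n. E (Suc k') + (if j = i then E k' else 0))"
      unfolding sum_words_Suc
      by (rule sum.cong) (auto simp: E_def sum.distrib)
    also have "\<dots> = n * E (Suc k') + E k'" using assms by (simp add: sum.distrib)
    finally have "n ^ Suc k' * (\<Sum>xs\<in>words n (Suc l). count (mset xs) i choose Suc k')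
        = n * (n ^ Suc k' * E (Suc k')) + n * (n ^ k' * E k')"
      by (simp add: algebra_simps)
    also have "\<dots> = n * ((l choose Suc k') * n ^ l) + n * ((l choose k') * n ^ l)"
      using Suc.IH by (simp only: E_def)
    finally show ?thesis using Suc by (simp add: algebra_simps)
  qed
qed

section \<open>Layers of a word\<close>

text \<open>For \<open>k = 0\<close> this is the infinite set of all naturals, whence the recurring
  hypothesis \<open>0 < k\<close>.\<close>

definition occ :: "nat \<Rightarrow> nat list \<Rightarrow> nat set" where
  "occ k xs = {i. k \<le> count (mset xs) i}"

lemma occ_subset: "0 < k \<Longrightarrow> occ k xs \<subseteq> set xs"
  by (auto simp: occ_def) (metis count_mset_0_iff not_less)

lemma finite_occ: "0 < k \<Longrightarrow> finite (occ k xs)"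
  using occ_subset finite_subset by blast

text \<open>A letter lies in exactly as many layers as it has occurrences, and no count exceeds
  \<open>n\<close>.\<close>

lemma mset_eq_sum_occ:
  assumes "length xs \<le> n"
  shows "mset xs = (\<Sum>k\<in>{1..n}. mset_set (occ k xs))"
proof (rule multiset_eqI)
  fix i
  have "count (mset xs) i \<le> n" using assms count_le_size[of "mset xs" i] by simp
  then have "{k \<in> {1..n}. k \<le> count (mset xs) i} = {1..count (mset xs) i}" by auto
  moreover have "count (mset_set (occ k xs)) i = (if k \<le> count (mset xs) i then 1 else 0)"
    if "k \<in> {1..n}" for k
    using that finite_occ[of k xs] by (simp add: count_mset_set' occ_def)
  ultimately show "count (mset xs) i = count (\<Sum>k\<in>{1..n}. mset_set (occ k xs)) i"
    by (simp add: count_sum sum.If_cases Int_def)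
qed

lemma card_occ_le:
  assumes "0 < k"
  shows "k * card (occ k xs) \<le> length xs"
proof -
  have "k * card (occ k xs) = (\<Sum>i\<in>occ k xs. k)" by simp
  also have "\<dots> \<le> (\<Sum>i\<in>occ k xs. count (mset xs) i)" by (rule sum_mono) (simp add: occ_def)
  also have "\<dots> \<le> (\<Sum>i\<in>set xs. count (mset xs) i)"
    by (rule sum_mono2) (use occ_subset[OF assms] in auto)
  also have "\<dots> = length xs" using size_multiset_overloaded_eq[of "mset xs"] by simp
  finally show ?thesis .
qed

lemma mset_set_occ_map:
  assumes "\<sigma> permutes S" "0 < k"
  shows "mset_set (occ k (map \<sigma> xs)) = image_mset \<sigma> (mset_set (occ k xs))"
proof -
  have c: "count (mset (map \<sigma> xs)) (\<sigma> i) = count (mset xs) i" for i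
    using permutes_inj[OF assms(1)]
    by (cases "i \<in> set xs") (simp_all add: count_image_mset vimage_def inj_eq count_eq_zero_iff)
  have "occ k (map \<sigma> xs) = \<sigma> ` occ k xs"
  proof
    show "occ k (map \<sigma> xs) \<subseteq> \<sigma> ` occ k xs"
    proof
      fix j assume "j \<in> occ k (map \<sigma> xs)"
      moreover obtain i where "j = \<sigma> i" using permutes_surj[OF assms(1)] by blast
      ultimately show "j \<in> \<sigma> ` occ k xs" using c[of i] by (auto simp: occ_def)
    qed
    show "\<sigma> ` occ k xs \<subseteq> occ k (map \<sigma> xs)" using c by (auto simp: occ_def)
  qed
  then show ?thesis
    using permutes_inj_on[OF assms(1)] by (simp add: image_mset_mset_set)
qed

text \<open>The indicator of \<open>k \<le> c\<close> is at most \<open>c choose k\<close>, whose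
  sum over all words is known; then \<open>(n choose k) * fact k \<le> n ^ k\<close>.\<close>

lemma sum_card_occ_le:
  assumes "0 < k" "0 < n"
  shows "fact k * (\<Sum>xs\<in>words n n. card (occ k xs)) \<le> n * n ^ n"
proof -
  have card: "card (occ k xs) \<le> (\<Sum>i<n. count (mset xs) i choose k)" if "xs \<in> words n n" for xs
  proof -
    have "card (occ k xs) = (\<Sum>i\<in>occ k xs. 1)" by simp
    also have "\<dots> \<le> (\<Sum>i\<in>occ k xs. count (mset xs) i choose k)"
      by (rule sum_mono) (auto simp: occ_def Suc_le_eq)
    also have "\<dots> \<le> (\<Sum>i<n. count (mset xs) i choose k)"
      by (rule sum_mono2) (use that occ_subset[OF assms(1), of xs] in \<open>auto simp: words_def\<close>)
    finally show ?thesis .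
  qed
  have "n ^ k * (fact k * (\<Sum>xs\<in>words n n. card (occ k xs)))
      \<le> n ^ k * (fact k * (\<Sum>xs\<in>words n n. \<Sum>i<n. count (mset xs) i choose k))"
    by (intro mult_le_mono2 sum_mono card)
  also have "\<dots> = fact k * (\<Sum>i<n. n ^ k * (\<Sum>xs\<in>words n n. count (mset xs) i choose k))"
    by (subst sum.swap) (simp add: sum_distrib_left mult_ac)
  also have "\<dots> = fact k * (n * ((n choose k) * n ^ n))" by (simp add: sum_words_choose)
  also have "\<dots> = ((n choose k) * fact k) * (n * n ^ n)" by simp
  also have "\<dots> \<le> n ^ k * (n * n ^ n)" by (intro mult_le_mono1 binomial_fact_pow)
  finally show ?thesis using assms(2) by simp
qed

text \<open>At \<open>k = 3\<close> this says 5.76 \<le> 6; each further step multiplies the left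
  side by 4 and the right side by \<open>Suc k \<ge> 4\<close>.\<close>

lemma fact_ge_geometric: "3 \<le> k \<Longrightarrow> ((12 / 5) * 2 ^ (k - 3))\<^sup>2 \<le> (fact k :: real)"
proof (induction k rule: nat_induct_at_least)
  case base
  show ?case by (simp add: power2_eq_square eval_nat_numeral)
next
  case (Suc k)
  have "((12 / 5) * 2 ^ (Suc k - 3))\<^sup>2 = 4 * ((12 / 5) * 2 ^ (k - 3) :: real)\<^sup>2"
    using Suc.hyps by (auto simp: le_iff_add power2_eq_square)
  also have "\<dots> \<le> real (Suc k) * fact k"
    using Suc by (intro mult_mono) auto
  finally show ?case by simp
qed

text \<open>AM-GM, with equality at \<open>x = 1 / r\<^sup>2\<close>. The bound is affine in
  \<open>x\<close>, so it can be averaged knowing only the mean of \<open>x\<close>.\<close>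

lemma sqrt_le_weighted:
  fixes x r :: real
  assumes "0 \<le> x" and r: "0 < r"
  shows "sqrt x \<le> (x * r + 1 / r) / 2"
proof -
  have "0 \<le> (sqrt x * r - 1)\<^sup>2 / (2 * r)" using r by simp
  also have "(sqrt x * r - 1)\<^sup>2 = (sqrt x)\<^sup>2 * r\<^sup>2 - 2 * sqrt x * r + 1"
    by (simp add: power2_diff power_mult_distrib)
  also have "\<dots> / (2 * r) = (x * r + 1 / r) / 2 - sqrt x"
    using assms by (simp add: field_simps power2_eq_square)
  finally show ?thesis by simp
qed

context admissible_family begin

text \<open>Relabelling the letters permutes the words and carries layers to layers, so the sum may
  be averaged over all permutations and \<open>perm_sum_le\<close> applies to each layer. The mean
  layer size then controls the mean of the square roots.\<close>

lemma sum_words_\<tau>_occ_le: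
  fixes n
  defines "\<delta> \<equiv> \<tau> (mset_set {..<n})"
  assumes k: "3 \<le> k" and n: "0 < n" and small: "\<delta> \<le> 1 / 6"
  shows "(\<Sum>xs\<in>words n n. \<tau> (mset_set (occ k xs))) \<le> real n ^ n * (2 * \<delta> * (1 / 2) ^ (k - 3))"
proof -
  define P where "P = {\<sigma>. \<sigma> permutes {..<n}}"
  define S where "S = (\<Sum>xs\<in>words n n. \<tau> (mset_set (occ k xs)))"
  \<comment> \<open>Chosen so that \<open>r\<^sup>2 \<le> fact k\<close>: the mean of
    \<open>card (occ k xs) / n\<close> is then at most \<open>1 / r\<^sup>2\<close>.\<close>
  define r :: real where "r = (12 / 5) * 2 ^ (k - 3)"
  have k0: "0 < k" using k by simp
  have r: "0 < r" by (simp add: r_def)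
  have \<delta>: "0 \<le> \<delta>" by (simp add: \<delta>_def \<tau>_nonneg)
  have P: "card P = fact n"
    by (simp add: P_def card_permutations)
  have "fact n * S = (\<Sum>\<sigma>\<in>P. \<Sum>xs\<in>words n n. \<tau> (mset_set (occ k (map \<sigma> xs))))"
    using P by (simp add: P_def S_def sum_words_map[where h = "\<lambda>xs. \<tau> (mset_set (occ k xs))"])
  also have "\<dots> = (\<Sum>xs\<in>words n n. \<Sum>\<sigma>\<in>P. \<tau> (image_mset \<sigma> (mset_set (occ k xs))))"
    by (subst sum.swap) (simp add: P_def mset_set_occ_map[OF _ k0])
  finally have "(1 - \<delta>) * (fact n * S)
      = (\<Sum>xs\<in>words n n. (1 - \<delta>) * (\<Sum>\<sigma>\<in>P. \<tau> (image_mset \<sigma> (mset_set (occ k xs)))))"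
    by (simp add: sum_distrib_left)
  also have "\<dots> \<le> (\<Sum>xs\<in>words n n. 4 * sqrt (card (occ k xs) / n) * \<delta> * fact n)"
  proof (rule sum_mono)
    fix xs assume xs: "xs \<in> words n n"
    have "3 * card (occ k xs) \<le> k * card (occ k xs)" using k by simp
    also have "\<dots> \<le> n" using card_occ_le[OF k0, of xs] xs by (simp add: words_def)
    finally show "(1 - \<delta>) * (\<Sum>\<sigma>\<in>P. \<tau> (image_mset \<sigma> (mset_set (occ k xs))))
        \<le> 4 * sqrt (card (occ k xs) / n) * \<delta> * fact n"
      using occ_subset[OF k0, of xs] xs unfolding P_def \<delta>_def
      by (intro perm_sum_le) (auto simp: words_def)
  qed
  also have "\<dots> = fact n * (4 * \<delta> * (\<Sum>xs\<in>words n n. sqrt (card (occ k xs) / n)))"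
    by (simp add: sum_distrib_left mult_ac)
  finally have S: "(1 - \<delta>) * S \<le> 4 * \<delta> * (\<Sum>xs\<in>words n n. sqrt (card (occ k xs) / n))"
    by (simp add: mult.left_commute)
  have card: "(\<Sum>xs\<in>words n n. real (card (occ k xs))) \<le> real n * real n ^ n / r\<^sup>2"
  proof -
    have "real (fact k * (\<Sum>xs\<in>words n n. card (occ k xs))) \<le> real (n * n ^ n)"
      using sum_card_occ_le[OF k0 n] by (simp only: of_nat_le_iff)
    then have "fact k * (\<Sum>xs\<in>words n n. real (card (occ k xs))) \<le> real n * real n ^ n" by simp
    moreover have "r\<^sup>2 * (\<Sum>xs\<in>words n n. real (card (occ k xs)))
        \<le> fact k * (\<Sum>xs\<in>words n n. real (card (occ k xs)))"
      unfolding r_def by (intro mult_right_mono fact_ge_geometric k sum_nonneg) auto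
    ultimately show ?thesis using r by (simp add: pos_le_divide_eq mult.commute)
  qed
  have "(\<Sum>xs\<in>words n n. sqrt (card (occ k xs) / n))
      \<le> (\<Sum>xs\<in>words n n. (card (occ k xs) / n * r + 1 / r) / 2)"
    by (intro sum_mono sqrt_le_weighted[OF _ r]) auto
  also have "\<dots> = ((\<Sum>xs\<in>words n n. real (card (occ k xs))) * (r / n) + real n ^ n / r) / 2"
    by (simp add: sum.distrib add_divide_distrib sum_distrib_right flip: sum_divide_distrib)
  also have "\<dots> \<le> ((real n * real n ^ n / r\<^sup>2) * (r / n) + real n ^ n / r) / 2"
    using r by (intro divide_right_mono add_right_mono mult_right_mono card) auto
  also have "\<dots> = real n ^ n / r" using r n by (simp add: power2_eq_square field_simps)
  finally have "4 * \<delta> * (\<Sum>xs\<in>words n n. sqrt (card (occ k xs) / n)) \<le> 4 * \<delta> * (real n ^ n / r)"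
    using \<delta> by (intro mult_left_mono) auto
  with S have "(1 - \<delta>) * S \<le> 4 * \<delta> * (real n ^ n / r)" by linarith
  moreover have "5 / 6 * S \<le> (1 - \<delta>) * S"
    using small by (intro mult_right_mono) (auto simp: S_def intro!: sum_nonneg \<tau>_nonneg)
  \<comment> \<open>The constants match: 6/5 * 4 * 5/12 = 2.\<close>
  ultimately have "S \<le> 6 / 5 * (4 * \<delta> * (real n ^ n / r))" by simp
  also have "\<dots> = real n ^ n * (2 * \<delta> * (1 / 2) ^ (k - 3))"
    by (simp add: r_def power_divide)
  finally show ?thesis by (simp add: S_def)
qed

text \<open>The layers \<open>k = 1, 2\<close> cost \<open>\<delta>\<close> each, the layers \<open>k \<ge> 3\<close> together at most \<open>4 \<delta>\<close>.\<close>

lemma sum_words_\<tau>_le: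
  assumes n: "0 < n"
  shows "(\<Sum>xs\<in>words n n. \<tau> (mset xs)) \<le> real n ^ n * (6 * \<tau> (mset_set {..<n}))"
proof -
  define \<delta> where "\<delta> = \<tau> (mset_set {..<n})"
  have \<delta>: "0 \<le> \<delta>" by (simp add: \<delta>_def \<tau>_nonneg)
  show ?thesis
  proof (cases "\<delta> \<le> 1 / 6")
    \<comment> \<open>Here \<open>\<tau> \<le> 1 < 6 * \<delta>\<close> for every word.\<close>
    case False
    have "(\<Sum>xs\<in>words n n. \<tau> (mset xs)) \<le> (\<Sum>xs\<in>words n n. 1)"
      by (intro sum_mono \<tau>_le_1)
    also have "\<dots> = real n ^ n * 1" by simp
    also have "\<dots> \<le> real n ^ n * (6 * \<delta>)" using False by (intro mult_left_mono) auto
    finally show ?thesis by (simp add: \<delta>_def)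
  next
    case True
    define f where "f k xs = \<tau> (mset_set (occ k xs))" for k xs
    have le: "\<tau> (mset xs) \<le> 2 * \<delta> + (\<Sum>k\<in>{3..n}. f k xs)" if xs: "xs \<in> words n n" for xs
    proof -
      have \<delta>_le: "f k xs \<le> \<delta>" if "0 < k" for k
        unfolding f_def \<delta>_def
        by (intro \<tau>_mono subset_imp_msubset_mset_set)
           (use occ_subset[OF that, of xs] xs in \<open>auto simp: words_def\<close>)
      have "\<tau> (mset xs) \<le> (\<Sum>k\<in>{1..n}. f k xs)"
        using mset_eq_sum_occ[of xs n] \<tau>_sum_le[of "\<lambda>k. mset_set (occ k xs)" "{1..n}"] xs
        by (simp add: words_def f_def)
      \<comment> \<open>Only an inequality, since for \<open>n = 1\<close> the index 2 is
        new.\<close>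
      also have "\<dots> \<le> (\<Sum>k\<in>{1, 2} \<union> {3..n}. f k xs)"
        by (rule sum_mono2) (auto simp: f_def \<tau>_nonneg)
      also have "\<dots> = f 1 xs + f 2 xs + (\<Sum>k\<in>{3..n}. f k xs)"
        by (subst sum.union_disjoint) auto
      finally show ?thesis using \<delta>_le[of 1] \<delta>_le[of 2] by simp
    qed
    have geom: "(\<Sum>k\<in>{3..n}. (1 / 2 :: real) ^ (k - 3)) \<le> 2"
    proof -
      have "(\<Sum>k\<in>{3..n}. (1 / 2 :: real) ^ (k - 3)) \<le> (\<Sum>k\<in>{3..<3 + n}. (1 / 2) ^ (k - 3))"
        by (rule sum_mono2) auto
      also have "\<dots> = (\<Sum>k<n. (1 / 2) ^ k)"
        by (rule sum.reindex_bij_witness[of _ "\<lambda>k. k + 3" "\<lambda>k. k - 3"]) auto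
      also have "\<dots> \<le> 2" by (simp add: sum_gp_strict)
      finally show ?thesis .
    qed
    have "(\<Sum>xs\<in>words n n. \<tau> (mset xs)) \<le> (\<Sum>xs\<in>words n n. 2 * \<delta> + (\<Sum>k\<in>{3..n}. f k xs))"
      by (intro sum_mono le)
    also have "\<dots> = real n ^ n * (2 * \<delta>) + (\<Sum>k\<in>{3..n}. \<Sum>xs\<in>words n n. f k xs)"
      by (simp add: sum.distrib) (rule sum.swap)
    also have "\<dots> \<le> real n ^ n * (2 * \<delta>) + (\<Sum>k\<in>{3..n}. real n ^ n * (2 * \<delta> * (1 / 2) ^ (k - 3)))"
      using sum_words_\<tau>_occ_le[OF _ n] True unfolding f_def \<delta>_def
      by (intro add_left_mono sum_mono) auto
    also have "\<dots> = real n ^ n * (2 * \<delta>) + real n ^ n * (2 * \<delta>) * (\<Sum>k\<in>{3..n}. (1 / 2) ^ (k - 3))"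
      by (simp add: sum_distrib_left mult_ac)
    also have "\<dots> \<le> real n ^ n * (2 * \<delta>) + real n ^ n * (2 * \<delta>) * 2"
      using \<delta> by (intro add_left_mono mult_left_mono geom) auto
    finally show ?thesis by (simp add: \<delta>_def algebra_simps)
  qed
qed

section \<open>Multilinearity of the convolution power\<close>

lemma supp_avg_subset: "supp_fm (\<lambda>x. (\<Sum>i<n. \<eta> i x) / real n) \<subseteq> (\<Union>i<n. supp_fm (\<eta> i))"
proof
  fix x assume "x \<in> supp_fm (\<lambda>x. (\<Sum>i<n. \<eta> i x) / real n)"
  then have "(\<Sum>i<n. \<eta> i x) \<noteq> 0" by (simp add: supp_fm_def)
  then show "x \<in> (\<Union>i<n. supp_fm (\<eta> i))"
    unfolding supp_fm_def by (metis (mono_tags) UN_iff mem_Collect_eq sum.neutral)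
qed

lemma finite_supp_fm: "finite (supp_fm (\<eta> i))"
  using fin_pos by (simp add: fin_pos_measure_def)

lemma fm_integral_avg:
  "fm_integral (\<lambda>x. (\<Sum>i<n. \<eta> i x) / real n) f = (\<Sum>i<n. fm_integral (\<eta> i) f) / real n"
proof -
  define S where "S = (\<Union>i<n. supp_fm (\<eta> i))"
  have S: "finite S" by (simp add: S_def finite_supp_fm)
  have "supp_fm (\<lambda>x. (\<Sum>i<n. \<eta> i x) / real n) \<subseteq> S"
    unfolding S_def by (rule supp_avg_subset)
  moreover have "supp_fm (\<eta> i) \<subseteq> S" if "i < n" for i using that by (auto simp: S_def)
  ultimately show ?thesis using S
    by (simp add: fm_integral_superset sum_distrib_right sum_divide_distrib) (rule sum.swap)
qed

lemma mint_fm_integral: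
  "mint M (\<lambda>x. fm_integral (\<eta> i) (\<lambda>y. f (x + y))) = mint (add_mset i M) f"
  using mint_union[of M "{#i#}" f] by (simp add: mint_add_mset[of i "{#}"])

text \<open>Multilinear expansion: each further factor of the average prepends one freely chosen
  letter to the word.\<close>

lemma fm_integral_avg_pow:
  fixes n
  defines "\<mu> \<equiv> \<lambda>x. (\<Sum>i<n. \<eta> i x) / real n"
  shows "fm_integral (fm_conv_pow \<mu> l) f = (\<Sum>xs\<in>words n l. mint (mset xs) f) / real n ^ l"
proof (induction l arbitrary: f)
  case 0
  show ?case by (simp add: fm_integral_dirac0)
next
  case (Suc l)
  have fin: "finite (supp_fm \<mu>)"
    using finite_subset[OF supp_avg_subset] finite_supp_fm unfolding \<mu>_def by blast
  have "fm_integral (fm_conv_pow \<mu> (Suc l)) f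
      = (\<Sum>xs\<in>words n l. mint (mset xs) (\<lambda>x. (\<Sum>i<n. fm_integral (\<eta> i) (\<lambda>y. f (x + y))) / n)) / real n ^ l"
    by (simp add: fm_integral_conv[OF finite_supp_fm_conv_pow[OF fin] fin] Suc.IH)
       (simp add: \<mu>_def fm_integral_avg)
  also have "\<dots> = (\<Sum>xs\<in>words n l. \<Sum>i<n. mint (mset (i # xs)) f) / real n ^ Suc l"
    by (simp add: mint_fm_integral mint_divide mint_sum flip: sum_divide_distrib)
  also have "\<dots> = (\<Sum>xs\<in>words n (Suc l). mint (mset xs) f) / real n ^ Suc l"
    unfolding sum_words_Suc by (subst sum.swap) (rule refl)
  finally show ?case .
qed

lemma fm_integral_conv_prod:
  "fm_integral (fm_conv_prod \<eta> n) f = mint (mset_set {..<n}) f"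
proof (induction n arbitrary: f)
  case 0
  show ?case by (simp add: fm_integral_dirac0)
next
  case (Suc n)
  have "fm_integral (fm_conv_prod \<eta> (Suc n)) f
      = mint (mset_set {..<n}) (\<lambda>x. fm_integral (\<eta> n) (\<lambda>y. f (x + y)))"
    by (simp add: fm_integral_conv finite_supp_fm finite_supp_fm_conv_prod Suc.IH)
  then show ?case by (simp add: mint_fm_integral lessThan_Suc)
qed

lemma T_avg_pow_le:
  assumes "0 < n"
  shows "T (fm_conv_pow (\<lambda>x. (\<Sum>i<n. \<eta> i x) / real n) n) \<le> 6 * T (fm_conv_prod \<eta> n)"
proof -
  have "T (fm_conv_pow (\<lambda>x. (\<Sum>i<n. \<eta> i x) / real n) n)
      = (\<Sum>xs\<in>words n n. \<tau> (mset xs)) / real n ^ n"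
    by (simp add: T_eq fm_integral_avg_pow \<tau>_def)
  also have "\<dots> \<le> (real n ^ n * (6 * \<tau> (mset_set {..<n}))) / real n ^ n"
    by (intro divide_right_mono sum_words_\<tau>_le assms) simp
  also have "\<dots> = 6 * T (fm_conv_prod \<eta> n)"
    using assms by (simp add: T_eq fm_integral_conv_prod \<tau>_def)
  finally show ?thesis .
qed

end

section \<open>Passage to families that are admissible only below n\<close>

lemma fm_conv_prod_cong:
  "(\<And>i. i < n \<Longrightarrow> \<eta> i = \<eta>' i) \<Longrightarrow> fm_conv_prod \<eta> n = fm_conv_prod \<eta>' n"
  by (induction n) auto

theorem theorem2:
  shows "\<exists>C0::real. C0 < 6.7129 \<and>
    (\<forall>(n::nat) (\<eta>::nat \<Rightarrow> real \<Rightarrow> real). n \<ge> 1 \<longrightarrow> (\<forall>i<n. admissible (\<eta> i)) \<longrightarrow>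
       T (fm_conv_pow (\<lambda>x. (\<Sum>i<n. \<eta> i x) / real n) n) \<le> C0 * T (fm_conv_prod \<eta> n))"
proof (intro exI[of _ 6] conjI allI impI)
  fix n :: nat and \<eta> :: "nat \<Rightarrow> real \<Rightarrow> real"
  assume n: "n \<ge> 1" and adm: "\<forall>i<n. admissible (\<eta> i)"
  \<comment> \<open>Padding with the unit mass at 0 makes every index admissible, as the locale
    demands; both sides depend only on indices below \<open>n\<close>.\<close>
  define \<eta>' where "\<eta>' i = (if i < n then \<eta> i else dirac0)" for i
  interpret admissible_family \<eta>'
    by standard (use adm admissible_dirac0 in \<open>auto simp: \<eta>'_def\<close>)
  have "fm_conv_prod \<eta> n = fm_conv_prod \<eta>' n"
    by (rule fm_conv_prod_cong) (simp add: \<eta>'_def)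
  moreover have "(\<lambda>x. (\<Sum>i<n. \<eta> i x) / real n) = (\<lambda>x. (\<Sum>i<n. \<eta>' i x) / real n)"
    by (simp add: \<eta>'_def)
  ultimately show "T (fm_conv_pow (\<lambda>x. (\<Sum>i<n. \<eta> i x) / real n) n) \<le> 6 * T (fm_conv_prod \<eta> n)"
    using T_avg_pow_le[of n] n by simp
qed simp

end
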